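(* Let $F=\{f_n\}_{n=1}^\infty$ be a sequence in a Hilbert space $\mathcal{H}$. If the sequence $\{f_n+f_{n+1}\}_{n=1}^\infty$ is linearly independent, then $F$ has a Fibonacci representation.
   Context: A sequence $F=\{f_n\}_{n=1}^\infty$ in $\mathcal{H}$ has a Fibonacci representation if there is a linear (not necessarily bounded) operator $T:\operatorname{span}\{f_n\}_{n=1}^\infty\to\operatorname{span}\{f_n\}_{n=1}^\infty$ such that $f_n=T(f_{n-1}+f_{n-2})$ for all $n\geqslant 3$. Here $\operatorname{span}$ is the set of finite linear combinations. A sequence $\{g_n\}_{n=1}^\infty$ is linearly independent if, for every $m$, $\sum_{k=1}^m c_kg_k=0$ with scalars $c_k$ implies $c_k=0$ for all $k=1,\dots,m$. *)

theory Defs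
  imports "HOL-Analysis.Analysis"
begin

text \<open>
  Real Hilbert spaces are the types of sort \<open>{real_inner, complete_space}\<close>. Complex Hilbert
  spaces are Banach spaces whose norm comes from a complex inner product. The inner product is
  linear in the first argument. Positive definiteness need not be assumed: it follows from
  \<open>cinner_commute\<close>, \<open>norm_eq_sqrt_cinner\<close> and the axioms for the norm.
\<close>

class complex_hilbert_space = banach +
  fixes scaleC :: "complex \<Rightarrow> 'a \<Rightarrow> 'a"
    and cinner :: "'a \<Rightarrow> 'a \<Rightarrow> complex"
  assumes scaleC_add_right: "scaleC c (x + y) = scaleC c x + scaleC c y"
    and scaleC_add_left: "scaleC (c + d) x = scaleC c x + scaleC d x"
    and scaleC_scaleC: "scaleC c (scaleC d x) = scaleC (c * d) x"
    and scaleC_of_real: "scaleC (complex_of_real r) x = r *\<^sub>R x"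
    and cinner_commute: "cinner x y = cnj (cinner y x)"
    and cinner_add_left: "cinner (x + y) z = cinner x z + cinner y z"
    and cinner_scaleC_left: "cinner (scaleC c x) y = c * cinner x y"
    and norm_eq_sqrt_cinner: "norm x = sqrt (Re (cinner x x))"

lemma vector_space_scaleC:
  "vector_space (scaleC :: complex \<Rightarrow> 'a \<Rightarrow> 'a::complex_hilbert_space)"
proof
  fix x :: 'a
  show "scaleC 1 x = x"
    using scaleC_of_real[of 1 x] by simp
qed (simp_all add: scaleC_add_right scaleC_add_left scaleC_scaleC)

instantiation complex :: complex_hilbert_space
begin

definition scaleC_complex :: "complex \<Rightarrow> complex \<Rightarrow> complex"
  where "scaleC_complex c x = c * x"

definition cinner_complex :: "complex \<Rightarrow> complex \<Rightarrow> complex"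
  where "cinner_complex x y = x * cnj y"

instance
  by standard
    (simp_all add: scaleC_complex_def cinner_complex_def algebra_simps scaleR_conv_of_real
      cmod_def power2_eq_square)

end

text \<open>
  The notions below take the scalar multiplication as a parameter, so that they apply to both
  scalar fields. Sequences are indexed from 1; their value at 0 plays no role.
\<close>

definition linearly_independent_seq ::
    "('k::field \<Rightarrow> 'v \<Rightarrow> 'v::ab_group_add) \<Rightarrow> (nat \<Rightarrow> 'v) \<Rightarrow> bool"
  where "linearly_independent_seq smul g \<longleftrightarrow>
    (\<forall>m c. (\<Sum>k=1..m. smul (c k) (g k)) = 0 \<longrightarrow> (\<forall>k\<in>{1..m}. c k = 0))"

text \<open>
  An operator on a subspace \<open>V\<close> is a total function of which only the values on \<open>V\<close> matter.
\<close>

definition linear_operator_on ::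
    "('k::field \<Rightarrow> 'v \<Rightarrow> 'v::ab_group_add) \<Rightarrow> 'v set \<Rightarrow> ('v \<Rightarrow> 'v) \<Rightarrow> bool"
  where "linear_operator_on smul V T \<longleftrightarrow>
    T \<in> V \<rightarrow> V \<and>
    (\<forall>x\<in>V. \<forall>y\<in>V. T (x + y) = T x + T y) \<and>
    (\<forall>c. \<forall>x\<in>V. T (smul c x) = smul c (T x))"

definition has_fibonacci_representation ::
    "('k::field \<Rightarrow> 'v \<Rightarrow> 'v::ab_group_add) \<Rightarrow> (nat \<Rightarrow> 'v) \<Rightarrow> bool"
  where "has_fibonacci_representation smul f \<longleftrightarrow>
    (\<exists>T. linear_operator_on smul (module.span smul (f ` {1..})) T \<and>
         (\<forall>n\<ge>3. f n = T (f (n - 1) + f (n - 2))))"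

end

theory Submission imports Defs begin

text \<open>
  Independence of the sums \<open>f n + f (n + 1)\<close> makes the prescription
  \<open>f n + f (n + 1) \<mapsto> f (n + 2)\<close> consistent, and any linear extension with values in the span of
  the prescribed vectors represents \<open>f\<close>.
\<close>

text \<open>A repeated value \<open>g i = g j\<close> at distinct indices would give the nontrivial
  relation \<open>g i - g j = 0\<close>. Injectivity is what later allows passing from a vector back
  to its index.\<close>

lemma (in vector_space) linearly_independent_seq_inj_on:
  assumes "linearly_independent_seq scale g"
  shows "inj_on g {1..}"
proof (rule inj_onI, rule ccontr)
  fix i j :: nat
  assume ij: "i \<in> {1..}" "j \<in> {1..}" "g i = g j" "i \<noteq> j"
  define c :: "nat \<Rightarrow> 'a" where "c k = of_bool (k = i) - of_bool (k = j)" for k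
  have "(\<Sum>k=1..max i j. scale (c k) (g k)) =
      (\<Sum>k=1..max i j. if k = i then g k else 0) - (\<Sum>k=1..max i j. if k = j then g k else 0)"
    unfolding sum_subtractf[symmetric] by (rule sum.cong) (auto simp: c_def scale_left_diff_distrib)
  also have "\<dots> = 0"
    using ij by (auto simp: sum.delta)
  finally have "c i = 0"
    using assms ij(1) unfolding linearly_independent_seq_def by force
  then show False
    using ij(4) by (simp add: c_def)
qed

text \<open>Bridge to independence of sets, which \<open>construct\<close> requires. By injectivity,
  a relation among finitely many vectors of the range pulls back to one among their indices, with
  the same coefficients.\<close>

lemma (in vector_space) linearly_independent_seq_independent:
  assumes "linearly_independent_seq scale g"
  shows "independent (g ` {1..})"
proof
  assume "dependent (g ` {1..})"
  then obtain S u v where S: "finite S" "S \<subseteq> g ` {1..}" "v \<in> S" "u v \<noteq> 0"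
    and u: "(\<Sum>w\<in>S. scale (u w) w) = 0"
    unfolding dependent_explicit by blast
  obtain I where I: "I \<subseteq> {1..}" "finite I" "S = g ` I"
    using S(1,2) by (meson finite_subset_image)
  have inj: "inj_on g I"
    using linearly_independent_seq_inj_on[OF assms] I(1) by (rule inj_on_subset)
  \<comment> \<open>Padding by zero turns a relation over the arbitrary finite index set
    \<open>I\<close> into one over an initial segment \<open>{1..m}\<close>, the only shape that
    sequence independence speaks about.\<close>
  define c where "c k = (if k \<in> I then u (g k) else 0)" for k
  define m where "m = Max I"
  have sub: "I \<subseteq> {1..m}"
    using I(1,2) by (auto simp: m_def)
  have "(\<Sum>k=1..m. scale (c k) (g k)) = (\<Sum>k\<in>I. scale (u (g k)) (g k))"
    using sub by (intro sum.mono_neutral_cong_right) (auto simp: c_def)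
  also have "\<dots> = (\<Sum>w\<in>S. scale (u w) w)"
    using inj by (simp add: I(3) sum.reindex)
  finally have "\<forall>k\<in>{1..m}. c k = 0"
    using assms u unfolding linearly_independent_seq_def by simp
  then show False
    using S(3,4) I(3) sub by (auto simp: c_def split: if_splits)
qed

lemma (in vector_space) fibonacci_representation_if_independent_sums:
  assumes "linearly_independent_seq scale (\<lambda>n. f n + f (n + 1))"
  shows "has_fibonacci_representation scale f"
proof -
  interpret VV: vector_space_pair scale scale ..
  define h where "h n = f n + f (n + 1)" for n
  define B where "B = h ` {1..}"
  \<comment> \<open>The value prescribed at the basis vector \<open>h n\<close> is
    \<open>f (n + 2)\<close>; reading \<open>n\<close> off from \<open>h n\<close> is legitimate
    because \<open>h\<close> is injective on the positive indices.\<close>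
  define t where "t b = f (the_inv_into {1..} h b + 2)" for b
  have h: "linearly_independent_seq scale h"
    using assms by (simp add: h_def[abs_def])
  have B: "independent B"
    unfolding B_def using h by (rule linearly_independent_seq_independent)
  define T where "T = VV.construct B t"
  have lin: "Vector_Spaces.linear scale scale T"
    unfolding T_def using B by (rule VV.linear_construct)
  have T_h: "T (h n) = f (n + 2)" if "n \<ge> 1" for n
    using VV.construct_basis[OF B, of "h n" t] that
      the_inv_into_f_f[OF linearly_independent_seq_inj_on[OF h], of n]
    by (simp add: T_def B_def t_def)
  \<comment> \<open>The summand 2 makes the index positive whatever the inverse returns.\<close>
  have t_B: "t ` B \<subseteq> f ` {1..}"
    by (auto simp: t_def)
  have "T x \<in> span (f ` {1..})" for x
    using VV.construct_in_span[OF B, of t x] span_mono[OF t_B] by (auto simp: T_def)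
  then have "linear_operator_on scale (span (f ` {1..})) T"
    unfolding linear_operator_on_def
    using VV.linear_add[OF lin] VV.linear_scale[OF lin] by auto
  moreover have "f n = T (f (n - 1) + f (n - 2))" if "n \<ge> 3" for n
  proof -
    obtain k where "n = k + 2" "k \<ge> 1"
      using \<open>n \<ge> 3\<close> by (intro that[of "n - 2"]) auto
    then show ?thesis
      using T_h[of k] by (simp add: h_def add.commute)
  qed
  ultimately show ?thesis
    unfolding has_fibonacci_representation_def by blast
qed

theorem theorem3p8:
  fixes f :: "nat \<Rightarrow> 'a::{real_inner, complete_space}"
    and g :: "nat \<Rightarrow> 'b::complex_hilbert_space"
  shows "(linearly_independent_seq scaleR (\<lambda>n. f n + f (n + 1)) \<longrightarrow>
            has_fibonacci_representation scaleR f) \<and>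
         (linearly_independent_seq scaleC (\<lambda>n. g n + g (n + 1)) \<longrightarrow>
            has_fibonacci_representation scaleC g)"
  using vector_space.fibonacci_representation_if_independent_sums[OF
      real_vector.vector_space_axioms, of f]
    vector_space.fibonacci_representation_if_independent_sums[OF vector_space_scaleC, of g]
  by blast

end
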